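(* Let $\pi\colon\mathbb{R}\to[0,1]$ be a minimal valid function that is piecewise linear over a complex $\mathcal{P}=\mathcal{P}_B$. Let $\tilde\pi\in\tilde\Pi^{\pi}(\mathbb{R},\mathbb{Z})$ be an effective perturbation function for $\pi$. If a point $(u,v)$ in a two-dimensional face $F\in\Delta\mathcal{P}$ satisfies $\Delta\pi_F(u,v)=0$, then the limits \[\lim_{\substack{x\to u\\ x\in\operatorname{int}(p_1(F))}}\tilde\pi(x),\qquad \lim_{\substack{y\to v\\ y\in\operatorname{int}(p_2(F))}}\tilde\pi(y)\qquad\text{and}\qquad \lim_{\substack{z\to u+v\\ z\in\operatorname{int}(p_3(F))}}\tilde\pi(z)\] exist (as real numbers).
   Context: Fix $f\in(0,1)$. A minimal valid function is a function $\pi\colon\mathbb{R}\to[0,1]$ that is $\mathbb{Z}$-periodic, subadditive ($\pi(x+y)\le\pi(x)+\pi(y)$ for all $x,y$), with $\pi(0)=0$, $\pi(f)=1$, and satisfying the symmetry condition $\pi(x)+\pi(f-x)=1$ for all $x\in\mathbb{R}$. A function $\tilde\pi\colon\mathbb{R}\to\mathbb{R}$ is an effective perturbation function for the minimal valid function $\pi$, written $\tilde\pi\in\tilde\Pi^{\pi}(\mathbb{R},\mathbb{Z})$, if there exists $\epsilon>0$ such that $\pi+\epsilon\tilde\pi$ and $\pi-\epsilon\tilde\pi$ are both minimal valid functions (for the same $f$). One-dimensional complex: for $0=x_0<x_1<\dots<x_n=1$ let $B=\{x_i+t : 0\le i\le n-1,\ t\in\mathbb{Z}\}$ (the breakpoints).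 $\mathcal{P}_B$ consists of the empty face, the singletons $\{x\}$, $x\in B$, and the closed intervals $[x_i+t,x_{i+1}+t]$, $0\le i\le n-1$, $t\in\mathbb{Z}$. A function $\pi\colon\mathbb{R}\to\mathbb{R}$ is piecewise linear over $\mathcal{P}_B$ if on the relative interior of each face of $\mathcal{P}_B$ it coincides with an affine linear function; such functions may be discontinuous at breakpoints. Two-dimensional complex: $\Delta\mathcal{P}$ is the polyhedral complex in $\mathbb{R}^2$ whose faces are the sets $F(I,J,K)=\{(x,y)\in\mathbb{R}^2 : x\in I,\ y\in J,\ x+y\in K\}$ with $I,J,K\in\mathcal{P}_B$. The projections are $p_1(x,y)=x$, $p_2(x,y)=y$, $p_3(x,y)=x+y$. Subadditivity slack: $\Delta\pi(x,y)=\pi(x)+\pi(y)-\pi(x+y)$. For a face $F\in\Delta\mathcal{P}$ and $(u,v)\in F$, $\Delta\pi_F(u,v)=\lim_{(x,y)\to(u,v),\ (x,y)\in\operatorname{rel\,int}(F)}\Delta\pi(x,y)$, which exists because $\Delta\pi$ is affine on $\operatorname{rel\,int}(F)$. *)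

theory Defs
  imports "HOL-Analysis.Analysis"
begin

definition minimal_valid :: "real \<Rightarrow> (real \<Rightarrow> real) \<Rightarrow> bool" where
  "minimal_valid f \<pi> \<longleftrightarrow>
     (\<forall>x. \<pi> x \<in> {0..1}) \<and>
     (\<forall>x (t::int). \<pi> (x + of_int t) = \<pi> x) \<and>
     (\<forall>x y. \<pi> (x + y) \<le> \<pi> x + \<pi> y) \<and>
     \<pi> 0 = 0 \<and> \<pi> f = 1 \<and>
     (\<forall>x. \<pi> x + \<pi> (f - x) = 1)"

definition effective_perturbations :: "real \<Rightarrow> (real \<Rightarrow> real) \<Rightarrow> (real \<Rightarrow> real) set" where
  "effective_perturbations f \<pi> =
     {\<pi>'. \<exists>\<epsilon>>0. minimal_valid f (\<lambda>x. \<pi> x + \<epsilon> * \<pi>' x) \<and>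
                 minimal_valid f (\<lambda>x. \<pi> x - \<epsilon> * \<pi>' x)}"

text \<open>Only the values \<open>x 0, \<dots>, x n\<close> of the sequence \<open>x\<close> are used below.\<close>

definition is_subdivision :: "nat \<Rightarrow> (nat \<Rightarrow> real) \<Rightarrow> bool" where
  "is_subdivision n x \<longleftrightarrow> x 0 = 0 \<and> x n = 1 \<and> (\<forall>i<n. x i < x (Suc i))"

definition breakpoints :: "nat \<Rightarrow> (nat \<Rightarrow> real) \<Rightarrow> real set" where
  "breakpoints n x = {x i + of_int t |i (t::int). i < n}"

definition complex_1d :: "nat \<Rightarrow> (nat \<Rightarrow> real) \<Rightarrow> real set set" where
  "complex_1d n x =
     {{}} \<union> {{b} |b. b \<in> breakpoints n x} \<union>
     {{x i + of_int t .. x (Suc i) + of_int t} |i (t::int). i < n}"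

definition piecewise_linear_over :: "real set set \<Rightarrow> (real \<Rightarrow> real) \<Rightarrow> bool" where
  "piecewise_linear_over P \<pi> \<longleftrightarrow>
     (\<forall>I\<in>P. \<exists>a b. \<forall>x\<in>rel_interior I. \<pi> x = a * x + b)"

definition face_2d :: "real set \<Rightarrow> real set \<Rightarrow> real set \<Rightarrow> (real \<times> real) set" where
  "face_2d I J K = {(x, y). x \<in> I \<and> y \<in> J \<and> x + y \<in> K}"

definition complex_2d :: "real set set \<Rightarrow> (real \<times> real) set set" where
  "complex_2d P = {face_2d I J K |I J K. I \<in> P \<and> J \<in> P \<and> K \<in> P}"

definition p1 :: "real \<times> real \<Rightarrow> real" where "p1 = (\<lambda>(x, y). x)"
definition p2 :: "real \<times> real \<Rightarrow> real" where "p2 = (\<lambda>(x, y). y)"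
definition p3 :: "real \<times> real \<Rightarrow> real" where "p3 = (\<lambda>(x, y). x + y)"

definition slack :: "(real \<Rightarrow> real) \<Rightarrow> real \<times> real \<Rightarrow> real" where
  "slack \<pi> = (\<lambda>(x, y). \<pi> x + \<pi> y - \<pi> (x + y))"

text \<open>
  The filter of \<open>q \<rightarrow> p\<close> with \<open>q \<in> S\<close>. Unlike \<open>at p within S\<close> it does not exclude
  \<open>q = p\<close>: for a singleton face, whose relative interior is the point itself, the limit
  of the slack has to be its value there, whereas \<open>at p within {p}\<close> is the trivial filter.
\<close>

definition approach :: "'a::topological_space \<Rightarrow> 'a set \<Rightarrow> 'a filter" where
  "approach p S = inf (nhds p) (principal S)"

definition face_slack :: "(real \<Rightarrow> real) \<Rightarrow> (real \<times> real) set \<Rightarrow> real \<times> real \<Rightarrow> real" where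
  "face_slack \<pi> F p = Lim (approach p (rel_interior F)) (slack \<pi>)"

end

theory Submission
  imports Defs
begin

text \<open>
  Why the limits exist. Both \<open>\<pi> + \<epsilon> \<pi>'\<close> and \<open>\<pi> - \<epsilon> \<pi>'\<close> are subadditive with values in \<open>[0, 1]\<close>. Hence
  \<open>\<pi>'\<close> is bounded and \<open>\<epsilon> |slack \<pi>'| \<le> slack \<pi>\<close> everywhere. On the interior of \<open>F\<close> the slack of \<open>\<pi>\<close>
  is affine and tends to \<open>0\<close> at \<open>(u, v)\<close>, so the slack of \<open>\<pi>'\<close> tends to \<open>0\<close> there as well. After the
  translation \<open>g1 a = \<pi>' (u + a)\<close>, \<open>g2 b = \<pi>' (v + b)\<close>, \<open>g3 c = \<pi>' (u + v + c)\<close>, this says that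
  \<open>g1 a + g2 b - g3 (a + b)\<close> becomes small as \<open>(a, b)\<close> tends to the origin inside the tangent cone of
  \<open>F\<close>, which has the form \<open>a \<in> X\<close>, \<open>b \<in> Y\<close>, \<open>a + b \<in> Z\<close> with each of \<open>X\<close>, \<open>Y\<close>, \<open>Z\<close> the whole line or an
  open half-line.

  Boundedness now forces \<open>g1\<close> to be Cauchy at \<open>0\<close>. If \<open>p\<close> and \<open>p'\<close> can be completed to points
  \<open>(p, z - p)\<close> and \<open>(p', z - p')\<close> with the same sum \<open>z\<close>, then both increments \<open>g1 (p + h) - g1 p\<close> and
  \<open>g1 (p' + h) - g1 p'\<close> are close to \<open>g3 (z + h) - g3 z\<close>; so the increments of \<open>g1\<close> over steps of
  length \<open>h\<close> depend little on the base point. If \<open>a' + h = a\<close> with \<open>a\<close> and \<open>a'\<close> very close to \<open>0\<close>,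
  then \<open>k\<close> consecutive steps still stay close to \<open>0\<close>, their increments add up to about
  \<open>k (g1 a - g1 a')\<close>, and this is at most twice the bound of \<open>g1\<close>. So \<open>g1 a - g1 a'\<close> is at most of
  order \<open>1 / k\<close> plus the error; this is \<open>approx_additive_Cauchy\<close>.

  The shape of the cone matters: the common sum \<open>z\<close> exists (\<open>common_third_coordinate\<close>) because the
  cone is bounded only by lines in the three directions on which \<open>a\<close>, \<open>b\<close> or \<open>a + b\<close> is constant. In
  a narrower cone the conclusion fails: around the diagonal of the positive quadrant,
  \<open>g1 = g3 = sin (ln (ln (1 / t)))\<close> and \<open>g2 = 0\<close> satisfy the hypothesis without having a limit. The
  statements for \<open>g2\<close> and \<open>g3\<close> follow from the one for \<open>g1\<close> by permuting the roles of the three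
  functions.
\<close>

section \<open>Approximate additivity on a cone\<close>

text \<open>
  The germs at \<open>0\<close> of the nonempty open intervals that have \<open>0\<close> in their closure.
\<close>

definition side :: "real set \<Rightarrow> bool" where
  "side S \<longleftrightarrow> S \<in> {UNIV, {0<..}, {..<0}}"

definition approx_additive ::
  "real set \<Rightarrow> real set \<Rightarrow> real set \<Rightarrow> (real \<Rightarrow> real) \<Rightarrow> (real \<Rightarrow> real) \<Rightarrow> (real \<Rightarrow> real) \<Rightarrow> bool" where
  "approx_additive X Y Z g1 g2 g3 \<longleftrightarrow>
     (\<forall>\<eta>>0. \<exists>r>0. \<forall>a\<in>X. \<forall>b\<in>Y. a + b \<in> Z \<longrightarrow> \<bar>a\<bar> < r \<longrightarrow> \<bar>b\<bar> < r \<longrightarrow>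
        \<bar>g1 a + g2 b - g3 (a + b)\<bar> \<le> \<eta>)"

lemma side_uminus: "side S \<Longrightarrow> side (uminus ` S)"
  unfolding side_def by auto

lemma approx_additive_swap:
  assumes "approx_additive X Y Z g1 g2 g3"
  shows "approx_additive Y X Z g2 g1 g3"
  unfolding approx_additive_def
proof (intro allI impI)
  fix \<eta> :: real assume "\<eta> > 0"
  then obtain r where "r > 0" and r: "\<forall>a\<in>X. \<forall>b\<in>Y. a + b \<in> Z \<longrightarrow> \<bar>a\<bar> < r \<longrightarrow> \<bar>b\<bar> < r \<longrightarrow>
        \<bar>g1 a + g2 b - g3 (a + b)\<bar> \<le> \<eta>"
    using assms unfolding approx_additive_def by blast
  then show "\<exists>r>0. \<forall>a\<in>Y. \<forall>b\<in>X. a + b \<in> Z \<longrightarrow> \<bar>a\<bar> < r \<longrightarrow> \<bar>b\<bar> < r \<longrightarrow>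
        \<bar>g2 a + g1 b - g3 (a + b)\<bar> \<le> \<eta>"
    by (metis add.commute)
qed

text \<open>
  The relation \<open>a + b = c\<close> can be read as \<open>c + (- b) = a\<close>, which moves the third function to the first
  place.
\<close>

lemma approx_additive_rotate:
  assumes "approx_additive X Y Z g1 g2 g3"
  shows "approx_additive Z (uminus ` Y) X g3 (\<lambda>b. - g2 (- b)) g1"
  unfolding approx_additive_def
proof (intro allI impI)
  fix \<eta> :: real assume "\<eta> > 0"
  then obtain r where "r > 0" and r: "\<forall>a\<in>X. \<forall>b\<in>Y. a + b \<in> Z \<longrightarrow> \<bar>a\<bar> < r \<longrightarrow> \<bar>b\<bar> < r \<longrightarrow>
        \<bar>g1 a + g2 b - g3 (a + b)\<bar> \<le> \<eta>"
    using assms unfolding approx_additive_def by blast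
  have "\<bar>g3 c + - g2 (- b) - g1 (c + b)\<bar> \<le> \<eta>"
    if "c \<in> Z" "b \<in> uminus ` Y" "c + b \<in> X" "\<bar>c\<bar> < r / 2" "\<bar>b\<bar> < r / 2" for b c
  proof -
    have "\<bar>g1 (c + b) + g2 (- b) - g3 ((c + b) + - b)\<bar> \<le> \<eta>"
      by (rule r[rule_format]) (use that \<open>r > 0\<close> in auto)
    then show ?thesis by simp
  qed
  then show "\<exists>r>0. \<forall>a\<in>Z. \<forall>b\<in>uminus ` Y. a + b \<in> X \<longrightarrow> \<bar>a\<bar> < r \<longrightarrow> \<bar>b\<bar> < r \<longrightarrow>
        \<bar>g3 a + - g2 (- b) - g1 (a + b)\<bar> \<le> \<eta>"
    using \<open>r > 0\<close> by (intro exI[of _ "r/2"]) auto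
qed

text \<open>
  Walking from \<open>a'\<close> through \<open>a\<close> and beyond does not leave a half-line, provided that the walk points
  away from the origin; \<open>|a'| \<le> |a|\<close> expresses this for half-lines of both orientations at once.
\<close>

lemma side_extend:
  assumes "side S" "a \<in> S" "a' \<in> S" "\<bar>a'\<bar> \<le> \<bar>a\<bar>" "0 \<le> t"
  shows "a' + t * (a - a') \<in> S"
proof -
  consider "S = UNIV" | "S = {0<..}" | "S = {..<0}"
    using assms(1) unfolding side_def by auto
  then show ?thesis
  proof cases
    case 2
    then have "0 \<le> t * (a - a')" using assms by auto
    moreover have "0 < a'" using assms 2 by auto
    ultimately show ?thesis using 2 by simp
  next
    case 3
    then have "t * (a - a') \<le> 0" using assms by (auto simp: mult_le_0_iff)
    moreover have "a' < 0" using assms 3 by auto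
    ultimately show ?thesis using 3 by simp
  qed auto
qed

text \<open>
  Applied with the constraints on the second coordinate and on the sum, this shows that the projection
  of the cone to the first axis is an intersection of two sides, along which \<open>side_extend\<close> allows
  one to walk.
\<close>

lemma side_fibre_projection:
  assumes "side Y" "side Z"
  shows "side {a. \<exists>b\<in>Y. a + b \<in> Z}"
proof -
  have 1: "\<exists>b>0. a + b > 0" "\<exists>b<0. a + b < 0" for a :: real
    by (auto intro: exI[of _ "\<bar>a\<bar> + 1"] exI[of _ "- \<bar>a\<bar> - 1"])
  have 2: "(\<exists>b>0. a + b < 0) \<longleftrightarrow> a < 0" "(\<exists>b<0. a + b > 0) \<longleftrightarrow> a > 0" for a :: real
    by (auto intro: exI[of _ "- a / 2"])
  have 3: "\<exists>b. a + b > 0" "\<exists>b. a + b < 0" "\<exists>b::real. b > 0" "\<exists>b::real. b < 0" for a :: real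
    using 1 by blast+
  have "{a. \<exists>b\<in>Y. a + b \<in> Z} \<in> {UNIV, {0<..}, {..<0}}"
    using assms unfolding side_def by (auto simp: 1 2 3 greaterThan_def lessThan_def)
  then show ?thesis by (simp add: side_def)
qed

text \<open>
  The geometric heart of the argument. Unless the constraints on \<open>z - p\<close> and on \<open>z\<close> pull in
  opposite directions, a \<open>z\<close> that is large compared with \<open>p\<close>, \<open>p'\<close> and \<open>h\<close> satisfies all of them. If
  they do, then the four base points all lie on one side of \<open>0\<close>, and the window left for \<open>z\<close>,
  such as \<open>max p p' < z < min 0 (- h)\<close>, is nonempty precisely because of that.
\<close>

lemma common_third_coordinate:
  fixes p p' h r :: real
  assumes "side Y" "side Z"
    and P: "{p, p + h, p', p' + h} \<subseteq> {a. \<exists>b\<in>Y. a + b \<in> Z}"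
    and r: "\<bar>p\<bar> < r" "\<bar>p + h\<bar> < r" "\<bar>p'\<bar> < r" "\<bar>p' + h\<bar> < r"
  obtains z where "z - p \<in> Y" "z - p' \<in> Y" "z \<in> Z" "z + h \<in> Z" "\<bar>z\<bar> \<le> 2 * r"
proof -
  have "\<exists>z. z - p \<in> Y \<and> z - p' \<in> Y \<and> z \<in> Z \<and> z + h \<in> Z \<and> \<bar>z\<bar> \<le> 2 * r"
  proof -
    consider "Y = UNIV \<or> Y = {0<..}" "Z = UNIV \<or> Z = {0<..}"
      | "Y = UNIV \<or> Y = {..<0}" "Z = UNIV \<or> Z = {..<0}"
      | "Y = {0<..}" "Z = {..<0}" | "Y = {..<0}" "Z = {0<..}"
      using assms unfolding side_def by auto
    then show ?thesis
    proof cases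
      case 1 then show ?thesis using r by (intro exI[of _ "2 * r"]) auto
    next
      case 2 then show ?thesis using r by (intro exI[of _ "- 2 * r"]) auto
    next
      case 3
      then have "p < 0" "p + h < 0" "p' < 0" "p' + h < 0" using P by auto
      then have "max p p' < min 0 (- h)" by auto
      then obtain z where "max p p' < z" "z < min 0 (- h)" using dense by blast
      then show ?thesis using 3 r by (intro exI[of _ z]) auto
    next
      case 4
      then have "p > 0" "p + h > 0" "p' > 0" "p' + h > 0" using P by auto
      then have "max 0 (- h) < min p p'" by auto
      then obtain z where "max 0 (- h) < z" "z < min p p'" using dense by blast
      then show ?thesis using 4 r by (intro exI[of _ z]) auto
    qed
  qed
  then show thesis using that by blast
qed

text \<open>
  The \<open>k\<close> increments telescope to \<open>g (a + k h) - g a\<close>, whose absolute value is at most \<open>2 M\<close>, while each of them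
  differs from the first one by at most \<open>\<eta>\<close>.
\<close>

lemma increment_le_of_almost_constant_increments:
  fixes g :: "real \<Rightarrow> real" and k :: nat
  assumes "k > 0" and M: "\<And>a. \<bar>g a\<bar> \<le> M"
    and \<eta>: "\<And>j. j < k \<Longrightarrow> \<bar>(g (a + real (Suc j) * h) - g (a + real j * h)) - (g (a + h) - g a)\<bar> \<le> \<eta>"
  shows "\<bar>g (a + h) - g a\<bar> \<le> 2 * M / k + \<eta>"
proof -
  define D where "D = g (a + h) - g a"
  have tel: "(\<Sum>j<k. g (a + real (Suc j) * h) - g (a + real j * h)) = g (a + k * h) - g a"
    by (subst sum_lessThan_telescope) simp
  have "\<bar>(g (a + k * h) - g a) - k * D\<bar>
      = \<bar>\<Sum>j<k. (g (a + real (Suc j) * h) - g (a + real j * h)) - D\<bar>"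
    by (subst sum_subtractf, subst tel) simp
  also have "\<dots> \<le> (\<Sum>j<k. \<eta>)"
    by (rule order_trans[OF sum_abs], rule sum_mono) (use \<eta> D_def in auto)
  finally have "\<bar>(g (a + k * h) - g a) - k * D\<bar> \<le> k * \<eta>" by simp
  then have "\<bar>k * D\<bar> \<le> 2 * M + k * \<eta>"
    using M[of "a + k * h"] M[of a] by linarith
  then have "k * \<bar>D\<bar> \<le> 2 * M + k * \<eta>" by (simp add: abs_mult)
  then show ?thesis
    using \<open>k > 0\<close> unfolding D_def by (simp add: field_simps)
qed

text \<open>
  On the set of those \<open>a\<close> that are first coordinates of points of the cone, both the comparison of
  increments at different base points and the walk in \<open>k\<close> steps are possible.
\<close>

lemma approx_additive_Cauchy:
  assumes sides: "side X" "side Y" "side Z"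
    and add: "approx_additive X Y Z g1 g2 g3"
    and M: "\<And>a. \<bar>g1 a\<bar> \<le> M" and "e > 0"
  shows "\<exists>s>0. \<forall>a a'. a \<in> X \<inter> {a. \<exists>b\<in>Y. a + b \<in> Z} \<longrightarrow> a' \<in> X \<inter> {a. \<exists>b\<in>Y. a + b \<in> Z} \<longrightarrow>
           \<bar>a\<bar> < s \<longrightarrow> \<bar>a'\<bar> < s \<longrightarrow> \<bar>g1 a - g1 a'\<bar> < e"
proof -
  define P where "P = {a. \<exists>b\<in>Y. a + b \<in> Z}"
  have "side P" unfolding P_def by (rule side_fibre_projection) (use sides in auto)
  have "e / 8 > 0" using \<open>e > 0\<close> by simp
  then obtain R where "R > 0" and R: "\<And>a b. a \<in> X \<Longrightarrow> b \<in> Y \<Longrightarrow> a + b \<in> Z \<Longrightarrow> \<bar>a\<bar> < R \<Longrightarrow> \<bar>b\<bar> < R \<Longrightarrow>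
        \<bar>g1 a + g2 b - g3 (a + b)\<bar> \<le> e / 8"
    using add unfolding approx_additive_def by blast
  (* For base points of size less than r, the common sum has size at most 2 r, so the second
     coordinates z - p stay below 3 r = R. *)
  define r where "r = R / 3"
  have "r > 0" using \<open>R > 0\<close> by (simp add: r_def)
  (* Four errors of size e / 8: two for each base point, in comparing its increment with
     g3 (z + h) - g3 z. *)
  have const: "\<bar>(g1 (p + h) - g1 p) - (g1 (p' + h) - g1 p')\<bar> \<le> e / 2"
    if "{p, p + h, p', p' + h} \<subseteq> X \<inter> P"
      and small: "\<bar>p\<bar> < r" "\<bar>p + h\<bar> < r" "\<bar>p'\<bar> < r" "\<bar>p' + h\<bar> < r" for p p' h
  proof -
    have "{p, p + h, p', p' + h} \<subseteq> {a. \<exists>b\<in>Y. a + b \<in> Z}"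
      using that unfolding P_def by blast
    then obtain z where z: "z - p \<in> Y" "z - p' \<in> Y" "z \<in> Z" "z + h \<in> Z" "\<bar>z\<bar> \<le> 2 * r"
      using common_third_coordinate[OF sides(2,3) _ small] by blast
    have X: "p \<in> X" "p + h \<in> X" "p' \<in> X" "p' + h \<in> X" using that by auto
    have zz: "p + h + (z - p) = z + h" "p' + h + (z - p') = z + h" by auto
    have small': "\<bar>p\<bar> < R" "\<bar>p + h\<bar> < R" "\<bar>p'\<bar> < R" "\<bar>p' + h\<bar> < R" "\<bar>z - p\<bar> < R" "\<bar>z - p'\<bar> < R"
      using small z(5) \<open>R > 0\<close> unfolding r_def by linarith+
    have "\<bar>g1 p + g2 (z - p) - g3 z\<bar> \<le> e / 8"
      "\<bar>g1 (p + h) + g2 (z - p) - g3 (z + h)\<bar> \<le> e / 8"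
      "\<bar>g1 p' + g2 (z - p') - g3 z\<bar> \<le> e / 8"
      "\<bar>g1 (p' + h) + g2 (z - p') - g3 (z + h)\<bar> \<le> e / 8"
      using R[OF X(1) z(1) _ small'(1,5)] R[OF X(2) z(1) _ small'(2,5)]
        R[OF X(3) z(2) _ small'(3,6)] R[OF X(4) z(2) _ small'(4,6)] z(3,4)
      unfolding zz by simp_all
    then show ?thesis by linarith
  qed
  obtain k :: nat where k: "real k > 4 * M / e" "k > 0"
    using reals_Archimedean2[of "max 0 (4 * M / e)"] by auto
  have k': "2 * M / k < e / 2"
    using k \<open>e > 0\<close> by (simp add: field_simps)
  (* The step h is shorter than 2 s, so k steps from a point of size less than s remain within
     s + 2 k s = r. *)
  define s where "s = r / (2 * k + 1)"
  have "s > 0" and s: "(2 * k + 1) * s = r" using \<open>r > 0\<close> by (auto simp: s_def)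
  have ordered: "\<bar>g1 a - g1 a'\<bar> < e"
    if a: "a \<in> X \<inter> P" "a' \<in> X \<inter> P" "\<bar>a\<bar> < s" "\<bar>a'\<bar> < s" "\<bar>a'\<bar> \<le> \<bar>a\<bar>" for a a'
  proof -
    define h where "h = a - a'"
    have inXP: "a' + real j * h \<in> X \<inter> P" for j
      using side_extend[of X a a' "real j"] side_extend[of P a a' "real j"] a sides \<open>side P\<close>
      unfolding h_def by auto
    have lt: "\<bar>a' + real j * h\<bar> < r" if "j \<le> k" for j
    proof -
      have "\<bar>real j * h\<bar> \<le> k * (2 * s)"
        unfolding abs_mult using that a by (intro mult_mono) (auto simp: h_def)
      moreover have "s + k * (2 * s) = r" using s by (simp add: algebra_simps)
      ultimately show ?thesis using a by linarith
    qed
    have "\<bar>g1 (a' + h) - g1 a'\<bar> \<le> 2 * M / k + e / 2"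
    proof (rule increment_le_of_almost_constant_increments[OF k(2) M])
      fix j assume "j < k"
      have S: "a' + real (Suc j) * h = (a' + real j * h) + h" by (simp add: algebra_simps)
      show "\<bar>(g1 (a' + real (Suc j) * h) - g1 (a' + real j * h)) - (g1 (a' + h) - g1 a')\<bar> \<le> e / 2"
        unfolding S
      proof (rule const)
        show "{a' + real j * h, a' + real j * h + h, a', a' + h} \<subseteq> X \<inter> P"
          using inXP[of j] inXP[of "Suc j", unfolded S] inXP[of 0] inXP[of 1] by simp
        show "\<bar>a' + real j * h\<bar> < r" "\<bar>a' + real j * h + h\<bar> < r" "\<bar>a'\<bar> < r" "\<bar>a' + h\<bar> < r"
          using lt[of j] lt[of "Suc j", unfolded S] lt[of 0] lt[of 1] \<open>j < k\<close> by simp_all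
      qed
    qed
    then show ?thesis using k' by (simp add: h_def)
  qed
  have "\<bar>g1 a - g1 a'\<bar> < e"
    if "a \<in> X \<inter> P" "a' \<in> X \<inter> P" "\<bar>a\<bar> < s" "\<bar>a'\<bar> < s" for a a'
    using ordered[of a a'] ordered[of a' a] that by (cases "\<bar>a'\<bar> \<le> \<bar>a\<bar>") (auto simp: abs_minus_commute)
  then show ?thesis using \<open>s > 0\<close> unfolding P_def by blast
qed

section \<open>From the Cauchy property to limits\<close>

lemma limit_exists_of_Cauchy:
  fixes g :: "'a::metric_space \<Rightarrow> 'b::complete_space"
  assumes "\<And>e. e > 0 \<Longrightarrow> \<exists>s>0. \<forall>x\<in>S. \<forall>y\<in>S. dist x u < s \<longrightarrow> dist y u < s \<longrightarrow> dist (g x) (g y) < e"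
  shows "\<exists>L. (g \<longlongrightarrow> L) (approach u S)"
proof (cases "approach u S = bot")
  case False
  have "cauchy_filter (filtermap g (approach u S))"
    unfolding cauchy_filter_metric_filtermap
  proof (intro allI impI)
    fix e :: real assume "e > 0"
    then obtain s where s: "s > 0" "\<forall>x\<in>S. \<forall>y\<in>S. dist x u < s \<longrightarrow> dist y u < s \<longrightarrow> dist (g x) (g y) < e"
      using assms by blast
    have "eventually (\<lambda>x. x \<in> S \<and> dist x u < s) (approach u S)"
      unfolding approach_def eventually_inf_principal eventually_nhds_metric using s(1) by blast
    then show "\<exists>P. eventually P (approach u S) \<and> (\<forall>x y. P x \<and> P y \<longrightarrow> dist (g x) (g y) < e)"
      using s(2) by blast
  qed
  then show ?thesis
    using complete_UNIV[where 'a='b] False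
    unfolding complete_uniform filterlim_def by (auto simp: filtermap_bot_iff)
qed (simp add: tendsto_bot)

lemma approx_additive_limit:
  fixes \<pi>' :: "real \<Rightarrow> real"
  assumes "side X" "side Y" "side Z" "approx_additive X Y Z (\<lambda>a. \<pi>' (u + a)) g2 g3"
    and "\<And>x. \<bar>\<pi>' x\<bar> \<le> M"
    and S: "\<And>x. x \<in> S \<Longrightarrow> x - u \<in> X \<and> (\<exists>b\<in>Y. x - u + b \<in> Z)"
  shows "\<exists>L. (\<pi>' \<longlongrightarrow> L) (approach u S)"
proof (rule limit_exists_of_Cauchy)
  fix e :: real assume "e > 0"
  from approx_additive_Cauchy[OF assms(1-5) this] obtain s where "s > 0" and
    s: "\<And>a a'. a \<in> X \<inter> {a. \<exists>b\<in>Y. a + b \<in> Z} \<Longrightarrow> a' \<in> X \<inter> {a. \<exists>b\<in>Y. a + b \<in> Z} \<Longrightarrow>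
           \<bar>a\<bar> < s \<Longrightarrow> \<bar>a'\<bar> < s \<Longrightarrow> \<bar>\<pi>' (u + a) - \<pi>' (u + a')\<bar> < e"
    by blast
  have "dist (\<pi>' x) (\<pi>' y) < e" if "x \<in> S" "y \<in> S" "dist x u < s" "dist y u < s" for x y
    using s[of "x - u" "y - u"] S that by (auto simp: dist_real_def)
  then show "\<exists>s>0. \<forall>x\<in>S. \<forall>y\<in>S. dist x u < s \<longrightarrow> dist y u < s \<longrightarrow> dist (\<pi>' x) (\<pi>' y) < e"
    using \<open>s > 0\<close> by blast
qed

section \<open>Two-dimensional faces and the slack\<close>

lemma open_interval_side:
  fixes l h u :: real
  assumes "l < h" "u \<in> {l..h}"
  obtains X r where "side X" "\<And>x. x \<in> {l<..<h} \<Longrightarrow> x - u \<in> X"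
    "r > 0" "\<And>a. a \<in> X \<Longrightarrow> \<bar>a\<bar> < r \<Longrightarrow> u + a \<in> {l<..<h}"
proof -
  consider "u = l" | "u = h" | "l < u" "u < h" using assms by force
  then show thesis
  proof cases
    case 1
    then show thesis using assms by (intro that[of "{0<..}" "h - l"]) (auto simp: side_def)
  next
    case 2
    then show thesis using assms by (intro that[of "{..<0}" "h - l"]) (auto simp: side_def)
  next
    case 3
    then show thesis using assms
      by (intro that[of UNIV "min (u - l) (h - u)"]) (auto simp: side_def)
  qed
qed

text \<open>
  The empty face and the singletons are degenerate intervals, so faces of the three kinds can be
  handled together.
\<close>

lemma complex_1d_intervals:
  assumes "I \<in> complex_1d n x"
  obtains l h where "I = {l..h}"
proof -
  have "{} = {1..0::real}" "\<And>b::real. {b} = {b..b}" by auto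
  then show thesis using assms that unfolding complex_1d_def by blast
qed

text \<open>
  The two coordinates and their sum are open maps, hence send interior points of the face to interior
  points of the three intervals.
\<close>

lemma interior_face_2d:
  "interior (face_2d {l1..h1} {l2..h2} {l3..h3}) = face_2d {l1<..<h1} {l2<..<h2} {l3<..<h3}"
proof -
  have eq: "face_2d I J K = fst -` I \<inter> snd -` J \<inter> (\<lambda>q. fst q + snd q) -` K" for I J K
    unfolding face_2d_def by auto
  have inner: "p q \<in> interior A"
    if "linear p" "surj p" "q \<in> interior S" "S \<subseteq> p -` A"
    for p :: "real \<times> real \<Rightarrow> real" and q A S
  proof -
    have "open (p ` interior S)"
      using that(1,2) by (intro open_surjective_linear_image) auto
    moreover have "p ` interior S \<subseteq> A" using that(4) interior_subset by blast
    ultimately show ?thesis using that(3) by (meson image_eqI interior_maximal subsetD)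
  qed
  have lin: "linear (\<lambda>q::real\<times>real. fst q + snd q)" "surj (\<lambda>q::real\<times>real. fst q + snd q)"
    by (auto intro!: linearI surjI[of _ "\<lambda>z. (z, 0)"] simp: algebra_simps)
  have "open (face_2d {l1<..<h1} {l2<..<h2} {l3<..<h3})"
    unfolding eq by (intro open_Int open_vimage continuous_intros open_greaterThanLessThan)
  moreover have "face_2d {l1<..<h1} {l2<..<h2} {l3<..<h3} \<subseteq> face_2d {l1..h1} {l2..h2} {l3..h3}"
    unfolding face_2d_def by auto
  moreover have "interior (face_2d {l1..h1} {l2..h2} {l3..h3}) \<subseteq> face_2d {l1<..<h1} {l2<..<h2} {l3<..<h3}"
  proof
    fix q assume q: "q \<in> interior (face_2d {l1..h1} {l2..h2} {l3..h3})"
    have "fst q \<in> interior {l1..h1}"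
      by (rule inner[OF linear_fst range_fst q]) (auto simp: eq)
    moreover have "snd q \<in> interior {l2..h2}"
      by (rule inner[OF linear_snd range_snd q]) (auto simp: eq)
    moreover have "fst q + snd q \<in> interior {l3..h3}"
      by (rule inner[OF lin q]) (auto simp: eq)
    ultimately show "q \<in> face_2d {l1<..<h1} {l2<..<h2} {l3<..<h3}" by (simp add: eq)
  qed
  ultimately show ?thesis by (meson interior_maximal subset_antisym)
qed

section \<open>Perturbations of minimal valid functions\<close>

lemma slack_perturbation_le:
  assumes "minimal_valid f (\<lambda>x. \<pi> x + \<epsilon> * \<pi>' x)" "minimal_valid f (\<lambda>x. \<pi> x - \<epsilon> * \<pi>' x)" "\<epsilon> > 0"
  shows "\<bar>slack \<pi>' q\<bar> \<le> slack \<pi> q / \<epsilon>"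
proof -
  obtain x y where q: "q = (x, y)" by (cases q)
  have "\<pi> (x + y) + \<epsilon> * \<pi>' (x + y) \<le> (\<pi> x + \<epsilon> * \<pi>' x) + (\<pi> y + \<epsilon> * \<pi>' y)"
    "\<pi> (x + y) - \<epsilon> * \<pi>' (x + y) \<le> (\<pi> x - \<epsilon> * \<pi>' x) + (\<pi> y - \<epsilon> * \<pi>' y)"
    using assms(1,2) unfolding minimal_valid_def by blast+
  then have "\<epsilon> * slack \<pi>' q \<le> slack \<pi> q" "- (\<epsilon> * slack \<pi>' q) \<le> slack \<pi> q"
    unfolding q slack_def by (auto simp: algebra_simps)
  then have "\<epsilon> * \<bar>slack \<pi>' q\<bar> \<le> slack \<pi> q" using \<open>\<epsilon> > 0\<close> by (simp add: abs_if)
  then show ?thesis using \<open>\<epsilon> > 0\<close> by (simp add: field_simps)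
qed

lemma bounded_perturbation:
  assumes "minimal_valid f (\<lambda>x. \<pi> x + \<epsilon> * \<pi>' x)" "minimal_valid f (\<lambda>x. \<pi> x - \<epsilon> * \<pi>' x)" "\<epsilon> > 0"
  shows "\<bar>\<pi>' x\<bar> \<le> 1 / \<epsilon>"
proof -
  have "\<pi> x + \<epsilon> * \<pi>' x \<in> {0..1}" "\<pi> x - \<epsilon> * \<pi>' x \<in> {0..1}"
    using assms(1,2) unfolding minimal_valid_def by blast+
  then have "\<epsilon> * \<bar>\<pi>' x\<bar> \<le> 1" using \<open>\<epsilon> > 0\<close> by (auto simp: abs_if)
  then show ?thesis using \<open>\<epsilon> > 0\<close> by (simp add: field_simps)
qed

text \<open>
  The face slack is a \<open>Lim\<close>, hence carries information only once convergence is known. On the relative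
  interior of the face all three arguments of \<open>\<pi>\<close> stay inside pieces on which \<open>\<pi>\<close> is affine, so the
  slack agrees there with a continuous function.
\<close>

lemma tendsto_face_slack:
  assumes pl: "piecewise_linear_over P \<pi>"
    and P: "{l1..h1} \<in> P" "{l2..h2} \<in> P" "{l3..h3} \<in> P"
    and lt: "l1 < h1" "l2 < h2" "l3 < h3"
    and F: "F = face_2d {l1..h1} {l2..h2} {l3..h3}"
    and rel: "rel_interior F = face_2d {l1<..<h1} {l2<..<h2} {l3<..<h3}"
    and q: "q \<in> closure (rel_interior F)"
  shows "(slack \<pi> \<longlongrightarrow> face_slack \<pi> F q) (approach q (rel_interior F))"
proof -
  have ri: "rel_interior {l..h} = {l<..<h}" if "l < h" for l h :: real
    using that by (rule rel_interior_real_box)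
  obtain a1 b1 where 1: "\<And>x. x \<in> {l1<..<h1} \<Longrightarrow> \<pi> x = a1 * x + b1"
    using pl P(1) ri[OF lt(1)] unfolding piecewise_linear_over_def by metis
  obtain a2 b2 where 2: "\<And>x. x \<in> {l2<..<h2} \<Longrightarrow> \<pi> x = a2 * x + b2"
    using pl P(2) ri[OF lt(2)] unfolding piecewise_linear_over_def by metis
  obtain a3 b3 where 3: "\<And>x. x \<in> {l3<..<h3} \<Longrightarrow> \<pi> x = a3 * x + b3"
    using pl P(3) ri[OF lt(3)] unfolding piecewise_linear_over_def by metis
  define A where "A q = (a1 * fst q + b1) + (a2 * snd q + b2) - (a3 * (fst q + snd q) + b3)"
    for q :: "real \<times> real"
  have "isCont A q" unfolding A_def by (intro continuous_intros)
  then have "(A \<longlongrightarrow> A q) (nhds q)" by (simp add: continuous_at tendsto_at_iff_tendsto_nhds)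
  then have "(A \<longlongrightarrow> A q) (approach q (rel_interior F))"
    unfolding approach_def by (rule tendsto_mono[OF inf_le1])
  moreover have "eventually (\<lambda>q. slack \<pi> q = A q) (approach q (rel_interior F))"
    unfolding approach_def eventually_inf_principal rel slack_def face_2d_def A_def
    by (intro always_eventually) (auto simp: 1 2 3)
  ultimately have lim: "(slack \<pi> \<longlongrightarrow> A q) (approach q (rel_interior F))"
    using tendsto_cong by blast
  have "approach q (rel_interior F) \<noteq> bot"
    using q unfolding approach_def closure_iff_nhds_not_empty trivial_limit_def
      eventually_inf_principal eventually_nhds by (metis disjoint_iff order_refl)
  then have "face_slack \<pi> F q = A q"
    unfolding face_slack_def using lim by (rule tendsto_Lim)
  then show ?thesis using lim by simp
qed

lemma interior_image_subset:
  fixes p :: "real \<times> real \<Rightarrow> real"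
  assumes "linear p" "convex F" "x \<in> interior (p ` F)"
  shows "x \<in> p ` rel_interior F"
  using rel_interior_convex_linear_image[OF assms(1,2)] assms(3) interior_subset_rel_interior by blast

section \<open>Existence of the limits\<close>

theorem theorem3p1:
  fixes f :: real and \<pi> \<pi>' :: "real \<Rightarrow> real"
    and n :: nat and x :: "nat \<Rightarrow> real"
    and F :: "(real \<times> real) set" and u v :: real
  assumes "0 < f" and "f < 1"
    and "minimal_valid f \<pi>"
    and "is_subdivision n x"
    and "piecewise_linear_over (complex_1d n x) \<pi>"
    and "\<pi>' \<in> effective_perturbations f \<pi>"
    and "F \<in> complex_2d (complex_1d n x)"
    and "aff_dim F = 2"
    and "(u, v) \<in> F"
    and "face_slack \<pi> F (u, v) = 0"
  shows "(\<exists>L::real. (\<pi>' \<longlongrightarrow> L) (approach u (interior (p1 ` F)))) \<and>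
         (\<exists>L::real. (\<pi>' \<longlongrightarrow> L) (approach v (interior (p2 ` F)))) \<and>
         (\<exists>L::real. (\<pi>' \<longlongrightarrow> L) (approach (u + v) (interior (p3 ` F))))"
proof -
  obtain l1 h1 l2 h2 l3 h3 where
    P: "{l1..h1} \<in> complex_1d n x" "{l2..h2} \<in> complex_1d n x" "{l3..h3} \<in> complex_1d n x"
    and F: "F = face_2d {l1..h1} {l2..h2} {l3..h3}"
    using \<open>F \<in> complex_2d _\<close> unfolding complex_2d_def
    by (smt (verit) complex_1d_intervals mem_Collect_eq)
  define G where "G = face_2d {l1<..<h1} {l2<..<h2} {l3<..<h3}"
  have "convex F"
  proof -
    have "F = fst -` {l1..h1} \<inter> snd -` {l2..h2} \<inter> (\<lambda>q. fst q + snd q) -` {l3..h3}"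
      unfolding F face_2d_def by auto
    moreover have "linear (\<lambda>q::real\<times>real. fst q + snd q)"
      by (intro linearI) (auto simp: algebra_simps)
    ultimately show ?thesis
      by (auto intro!: convex_Int convex_linear_vimage linear_fst linear_snd)
  qed
  have rel: "rel_interior F = G"
    unfolding G_def interior_face_2d[symmetric] F[symmetric]
    using \<open>aff_dim F = 2\<close> rel_interior_interior[of F] aff_dim_eq_full[of F] by simp
  have "G \<noteq> {}"
    using rel_interior_eq_empty[OF \<open>convex F\<close>] \<open>(u, v) \<in> F\<close> rel by auto
  then have lt: "l1 < h1" "l2 < h2" "l3 < h3" unfolding G_def face_2d_def by auto
  have uv: "u \<in> {l1..h1}" "v \<in> {l2..h2}" "u + v \<in> {l3..h3}"
    using \<open>(u, v) \<in> F\<close> unfolding F face_2d_def by auto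
  obtain \<epsilon> where "\<epsilon> > 0" and \<epsilon>: "minimal_valid f (\<lambda>x. \<pi> x + \<epsilon> * \<pi>' x)" "minimal_valid f (\<lambda>x. \<pi> x - \<epsilon> * \<pi>' x)"
    using \<open>\<pi>' \<in> _\<close> unfolding effective_perturbations_def by blast
  have bound: "\<bar>\<pi>' x\<bar> \<le> 1 / \<epsilon>" for x
    by (rule bounded_perturbation[OF \<epsilon> \<open>\<epsilon> > 0\<close>])
  have "(u, v) \<in> closure (rel_interior F)"
    using convex_closure_rel_interior[OF \<open>convex F\<close>] \<open>(u, v) \<in> F\<close> closure_subset by blast
  from tendsto_face_slack[OF assms(5) P lt F rel[unfolded G_def] this]
  have slack0: "(slack \<pi> \<longlongrightarrow> 0) (approach (u, v) G)"
    using \<open>face_slack \<pi> F (u, v) = 0\<close> rel by simp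
  obtain X r1 where X: "side X" "\<And>x. x \<in> {l1<..<h1} \<Longrightarrow> x - u \<in> X"
    "r1 > 0" "\<And>a. a \<in> X \<Longrightarrow> \<bar>a\<bar> < r1 \<Longrightarrow> u + a \<in> {l1<..<h1}"
    using open_interval_side[OF lt(1) uv(1)] by blast
  obtain Y r2 where Y: "side Y" "\<And>x. x \<in> {l2<..<h2} \<Longrightarrow> x - v \<in> Y"
    "r2 > 0" "\<And>a. a \<in> Y \<Longrightarrow> \<bar>a\<bar> < r2 \<Longrightarrow> v + a \<in> {l2<..<h2}"
    using open_interval_side[OF lt(2) uv(2)] by blast
  obtain Z r3 where Z: "side Z" "\<And>x. x \<in> {l3<..<h3} \<Longrightarrow> x - (u + v) \<in> Z"
    "r3 > 0" "\<And>a. a \<in> Z \<Longrightarrow> \<bar>a\<bar> < r3 \<Longrightarrow> (u + v) + a \<in> {l3<..<h3}"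
    using open_interval_side[OF lt(3) uv(3)] by blast
  (* Near the origin the cone given by X, Y, Z coincides with the translated interior of F. *)
  have add: "approx_additive X Y Z (\<lambda>a. \<pi>' (u + a)) (\<lambda>b. \<pi>' (v + b)) (\<lambda>c. \<pi>' (u + v + c))"
    unfolding approx_additive_def
  proof (intro allI impI)
    fix \<eta> :: real assume "\<eta> > 0"
    then have "eventually (\<lambda>q. \<bar>slack \<pi> q\<bar> < \<epsilon> * \<eta>) (approach (u, v) G)"
      using tendstoD[OF slack0, of "\<epsilon> * \<eta>"] \<open>\<epsilon> > 0\<close> by simp
    then obtain d where "d > 0" and
      d: "\<And>q. dist q (u, v) < d \<Longrightarrow> q \<in> G \<Longrightarrow> \<bar>slack \<pi> q\<bar> < \<epsilon> * \<eta>"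
      unfolding approach_def eventually_inf_principal eventually_nhds_metric by blast
    define r where "r = Min {r1, r2, r3 / 2, d / 2}"
    have r: "r > 0" "r \<le> r1" "r \<le> r2" "r \<le> r3 / 2" "r \<le> d / 2"
      using X(3) Y(3) Z(3) \<open>d > 0\<close> by (auto simp: r_def)
    have "\<bar>\<pi>' (u + a) + \<pi>' (v + b) - \<pi>' (u + v + (a + b))\<bar> \<le> \<eta>"
      if ab: "a \<in> X" "b \<in> Y" "a + b \<in> Z" "\<bar>a\<bar> < r" "\<bar>b\<bar> < r" for a b
    proof -
      have "dist (u + a, v + b) (u, v) \<le> \<bar>a\<bar> + \<bar>b\<bar>"
        unfolding dist_Pair_Pair dist_real_def using sqrt_sum_squares_le_sum_abs[of a b] by simp
      moreover have "\<bar>a\<bar> + \<bar>b\<bar> < d" using r ab by linarith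
      moreover have "u + a + (v + b) = u + v + (a + b)" by simp
      moreover have "(u + a, v + b) \<in> G"
        using X(4)[of a] Y(4)[of b] Z(4)[of "a + b"] ab r
        unfolding G_def face_2d_def by (auto simp: algebra_simps)
      ultimately have "\<bar>slack \<pi> (u + a, v + b)\<bar> < \<epsilon> * \<eta>" using d by force
      then have "slack \<pi> (u + a, v + b) / \<epsilon> \<le> \<eta>" using \<open>\<epsilon> > 0\<close> by (simp add: field_simps)
      with slack_perturbation_le[OF \<epsilon> \<open>\<epsilon> > 0\<close>, of "(u + a, v + b)"]
      show ?thesis unfolding slack_def by (simp add: algebra_simps)
    qed
    then show "\<exists>r>0. \<forall>a\<in>X. \<forall>b\<in>Y. a + b \<in> Z \<longrightarrow> \<bar>a\<bar> < r \<longrightarrow> \<bar>b\<bar> < r \<longrightarrow>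
        \<bar>\<pi>' (u + a) + \<pi>' (v + b) - \<pi>' (u + v + (a + b))\<bar> \<le> \<eta>"
      using r(1) by blast
  qed
  (* The translated interior of F lies in the cone globally, so projections of F are covered by
     projections of the cone. *)
  have GT: "a - u \<in> X \<and> b - v \<in> Y \<and> (a + b) - (u + v) \<in> Z" if "(a, b) \<in> G" for a b
    using that X(2) Y(2) Z(2) unfolding G_def face_2d_def by auto
  have lin: "linear p1" "linear p2" "linear p3"
    by (auto intro!: linearI simp: p1_def p2_def p3_def algebra_simps)
  have "\<exists>L. (\<pi>' \<longlongrightarrow> L) (approach u (interior (p1 ` F)))"
  proof (rule approx_additive_limit[OF X(1) Y(1) Z(1) add bound])
    fix x assume "x \<in> interior (p1 ` F)"
    then obtain y where "(x, y) \<in> G"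
      using interior_image_subset[OF lin(1) \<open>convex F\<close>] rel by (force simp: p1_def)
    from GT[OF this] show "x - u \<in> X \<and> (\<exists>b\<in>Y. x - u + b \<in> Z)"
      by (auto intro!: bexI[of _ "y - v"] simp: algebra_simps)
  qed
  moreover have "\<exists>L. (\<pi>' \<longlongrightarrow> L) (approach v (interior (p2 ` F)))"
  proof (rule approx_additive_limit[OF Y(1) X(1) Z(1) approx_additive_swap[OF add] bound])
    fix y assume "y \<in> interior (p2 ` F)"
    then obtain x where "(x, y) \<in> G"
      using interior_image_subset[OF lin(2) \<open>convex F\<close>] rel by (force simp: p2_def)
    from GT[OF this] show "y - v \<in> Y \<and> (\<exists>b\<in>X. y - v + b \<in> Z)"
      by (auto intro!: bexI[of _ "x - u"] simp: algebra_simps)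
  qed
  moreover have "\<exists>L. (\<pi>' \<longlongrightarrow> L) (approach (u + v) (interior (p3 ` F)))"
  proof (rule approx_additive_limit[OF Z(1) side_uminus[OF Y(1)] X(1) approx_additive_rotate[OF add] bound])
    fix z assume "z \<in> interior (p3 ` F)"
    then obtain x y where "(x, y) \<in> G" and z: "z = x + y"
      using interior_image_subset[OF lin(3) \<open>convex F\<close>] rel by (force simp: p3_def)
    from GT[OF this(1)] show "z - (u + v) \<in> Z \<and> (\<exists>b\<in>uminus ` Y. z - (u + v) + b \<in> X)"
      unfolding z by (auto intro!: bexI[of _ "y - v"] simp: algebra_simps)
  qed
  ultimately show ?thesis by blast
qed

end
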